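(* Let $\phi$ be a set of UTVPI constraints that is satisfiable (over the integers), and let $c$ be a UTVPI constraint of one of the forms $x-y\le d$, $x+y\le d$, $-x-y\le d$, $x\le d$, $-x\le d$. Then $\phi\models c$ if and only if for every edge $(u,v,e)\in E(c)$ (edge from $u$ to $v$ of weight $e$), either $wSP(u,v)\le e$ or $\rho(u)+\rho(-v)\le e$, where $wSP$ and $\rho$ are computed in $G_\phi$.
   Context: Variables range over $\mathbb{Z}$, and $\phi\models c$ means every integer solution of $\phi$ satisfies $c$. For a UTVPI constraint $c$, the edge set $E(c)$ over vertices $x^+,x^-$ (one pair per variable) is: - $x-y\le d$: $\{y^+\xrightarrow{d}x^+,\ x^-\xrightarrow{d}y^-\}$; - $x+y\le d$: $\{y^-\xrightarrow{d}x^+,\ x^-\xrightarrow{d}y^+\}$; - $-x-y\le d$: $\{y^+\xrightarrow{d}x^-,\ x^+\xrightarrow{d}y^-\}$; - $x\le d$: $\{x^-\xrightarrow{2d}x^+\}$; - $-x\le d$: $\{x^+\xrightarrow{2d}x^-\}$. The constraint graph $G_\phi$ has vertices $x^\pm$ for the variables and edge set $\bigcup_{c\in\phi}E(c)$. Write $-x^+:=x^-$ and $-x^-:=x^+$. For a graph without negative weight cycles, $wSP(u,v)$ is the minimum weight of a path from $u$ to $v$, or $+\infty$ if none exists. The bounds function is $\rho(u)=\lfloor wSP(u,-u)/2\rfloor$. *)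

theory Defs
  imports "Graph_Theory.Shortest_Path"
begin

text \<open>The five forms are \<open>x - y \<le> d\<close>, \<open>x + y \<le> d\<close>, \<open>- x - y \<le> d\<close>, \<open>x \<le> d\<close>, \<open>- x \<le> d\<close>.
  The two variables of a binary constraint are not required to be distinct.\<close>

datatype 'x utvpi =
    Diff_le 'x 'x int
  | Sum_le 'x 'x int
  | Neg_sum_le 'x 'x int
  | Upper 'x int
  | Lower 'x int

fun satisfies :: "('x \<Rightarrow> int) \<Rightarrow> 'x utvpi \<Rightarrow> bool" where
  "satisfies s (Diff_le x y d) \<longleftrightarrow> s x - s y \<le> d"
| "satisfies s (Sum_le x y d) \<longleftrightarrow> s x + s y \<le> d"
| "satisfies s (Neg_sum_le x y d) \<longleftrightarrow> - s x - s y \<le> d"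
| "satisfies s (Upper x d) \<longleftrightarrow> s x \<le> d"
| "satisfies s (Lower x d) \<longleftrightarrow> - s x \<le> d"

definition solution :: "('x \<Rightarrow> int) \<Rightarrow> 'x utvpi set \<Rightarrow> bool" where
  "solution s \<phi> \<longleftrightarrow> (\<forall>c\<in>\<phi>. satisfies s c)"

definition satisfiable :: "'x utvpi set \<Rightarrow> bool" where
  "satisfiable \<phi> \<longleftrightarrow> (\<exists>s. solution s \<phi>)"

definition entails :: "'x utvpi set \<Rightarrow> 'x utvpi \<Rightarrow> bool" (infix \<open>\<Turnstile>\<close> 50) where
  "\<phi> \<Turnstile> c \<longleftrightarrow> (\<forall>s. solution s \<phi> \<longrightarrow> satisfies s c)"

datatype 'x vertex = Pos 'x | Neg 'x

fun opp :: "'x vertex \<Rightarrow> 'x vertex" where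
  "opp (Pos x) = Neg x"
| "opp (Neg x) = Pos x"

text \<open>An edge \<open>(u, v, e)\<close> goes from \<open>u\<close> to \<open>v\<close> and has weight \<open>e\<close>.\<close>

type_synonym 'x edge = "'x vertex \<times> 'x vertex \<times> int"

fun edges :: "'x utvpi \<Rightarrow> 'x edge set" where
  "edges (Diff_le x y d) = {(Pos y, Pos x, d), (Neg x, Neg y, d)}"
| "edges (Sum_le x y d) = {(Neg y, Pos x, d), (Neg x, Pos y, d)}"
| "edges (Neg_sum_le x y d) = {(Pos y, Neg x, d), (Pos x, Neg y, d)}"
| "edges (Upper x d) = {(Neg x, Pos x, 2 * d)}"
| "edges (Lower x d) = {(Pos x, Neg x, 2 * d)}"

definition constraint_graph :: "'x utvpi set \<Rightarrow> ('x vertex, 'x edge) pre_digraph" where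
  "constraint_graph \<phi> =
     \<lparr>verts = UNIV, arcs = (\<Union>c\<in>\<phi>. edges c), tail = fst, head = (\<lambda>a. fst (snd a))\<rparr>"

lemma wf_digraph_constraint_graph: "wf_digraph (constraint_graph \<phi>)"
  by unfold_locales (simp_all add: constraint_graph_def)

definition weight :: "'x edge \<Rightarrow> real" where
  "weight a = real_of_int (snd (snd a))"

text \<open>The library's shortest-path distance \<open>\<mu>\<close> is an infimum over walks, with value \<open>\<infinity>\<close> if there
  is no walk. If \<open>\<phi>\<close> is satisfiable, then its graph has no negative cycles and the weights of the
  walks between two given vertices are integers bounded below, so the infimum is a minimum, and
  restricting it to paths without repeated vertices does not change it.\<close>

definition wSP :: "'x utvpi set \<Rightarrow> 'x vertex \<Rightarrow> 'x vertex \<Rightarrow> ereal" where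
  "wSP \<phi> u v = wf_digraph.\<mu> (constraint_graph \<phi>) weight u v"

text \<open>The floor of an infinite value is that value itself.\<close>

definition \<rho> :: "'x utvpi set \<Rightarrow> 'x vertex \<Rightarrow> ereal" where
  "\<rho> \<phi> u =
     (let w = wSP \<phi> u (opp u)
      in if \<bar>w\<bar> = \<infinity> then w else ereal (real_of_int \<lfloor>real_of_ereal w / 2\<rfloor>))"

end

theory Submission
  imports Defs
begin

text \<open>Soundness holds because every solution is a potential on the constraint graph. Completeness
  constructs a solution violating \<open>c\<close> out of a given solution \<open>s\<close>. If the value of a literal \<open>a\<close> is
  to be raised to \<open>m \<le> \<rho>(-a)\<close>, then walks from \<open>a\<close> and \<open>-a\<close> force a new upper bound \<open>q(x)\<close> and
  hence a new lower bound \<open>-q(-x)\<close> on every literal \<open>x\<close>. The pointwise median of \<open>s\<close>, \<open>q\<close> and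
  \<open>-q(-x)\<close> is again a solution, and it moves no literal further from \<open>s\<close> than the bounds force it
  to. Raising first \<open>-u\<close> and then \<open>v\<close> in this way makes the difference of \<open>v\<close> and \<open>u\<close> exceed \<open>e\<close>.
  No compactness is needed, so \<open>\<phi>\<close> may be infinite.\<close>

section \<open>Literals and solutions as antisymmetric potentials\<close>

lemma opp_opp [simp]: "opp (opp u) = u"
  by (cases u) auto

lemma edges_opp: "(u, v, e) \<in> edges c \<Longrightarrow> (opp v, opp u, e) \<in> edges c"
  by (cases c) auto

fun literal :: "('x \<Rightarrow> int) \<Rightarrow> 'x vertex \<Rightarrow> int" where
  "literal s (Pos x) = s x"
| "literal s (Neg x) = - s x"

lemma literal_opp: "literal s (opp u) = - literal s u"
  by (cases u) auto

text \<open>The two edges of a binary constraint state the same inequality, once for each of two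
  opposite literals. A unary bound appears doubled, as a bound on the difference of a literal and
  its opposite.\<close>

lemma satisfies_iff_edges:
  "satisfies s c \<longleftrightarrow> (\<forall>(u, v, e) \<in> edges c. literal s v \<le> literal s u + e)"
  by (cases c) auto

text \<open>Solutions read as functions on vertices. In this form the five constraint shapes are
  treated uniformly through their edges.\<close>

definition potential :: "'x utvpi set \<Rightarrow> ('x vertex \<Rightarrow> int) \<Rightarrow> bool" where
  "potential \<phi> p \<longleftrightarrow>
     (\<forall>u. p (opp u) = - p u) \<and> (\<forall>(u, v, e) \<in> (\<Union>c\<in>\<phi>. edges c). p v \<le> p u + e)"

lemma potential_opp: "potential \<phi> p \<Longrightarrow> p (opp u) = - p u"
  by (simp add: potential_def)

lemma potential_edge: "potential \<phi> p \<Longrightarrow> c \<in> \<phi> \<Longrightarrow> (u, v, e) \<in> edges c \<Longrightarrow> p v \<le> p u + e"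
  by (fastforce simp: potential_def)

lemma potential_literal_iff: "potential \<phi> (literal s) \<longleftrightarrow> solution s \<phi>"
  by (auto simp: potential_def solution_def satisfies_iff_edges literal_opp)

lemma literal_potential:
  assumes "potential \<phi> p"
  shows "literal (\<lambda>x. p (Pos x)) = p"
proof
  fix u show "literal (\<lambda>x. p (Pos x)) u = p u"
    using potential_opp[OF assms, of "Pos x" for x] by (cases u) auto
qed

section \<open>Walks, their integer weights and their mirror images\<close>

inductive walk_weight :: "'x utvpi set \<Rightarrow> 'x vertex \<Rightarrow> 'x vertex \<Rightarrow> int \<Rightarrow> bool" for \<phi> where
  refl: "walk_weight \<phi> u u 0"
| step: "c \<in> \<phi> \<Longrightarrow> (u, v, e) \<in> edges c \<Longrightarrow> walk_weight \<phi> v w k \<Longrightarrow> walk_weight \<phi> u w (e + k)"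

lemma walk_weight_trans:
  "walk_weight \<phi> u v k \<Longrightarrow> walk_weight \<phi> v w l \<Longrightarrow> walk_weight \<phi> u w (k + l)"
  by (induction rule: walk_weight.induct) (auto simp: add.assoc intro: walk_weight.step)

lemma walk_weight_snoc:
  "walk_weight \<phi> u v k \<Longrightarrow> c \<in> \<phi> \<Longrightarrow> (v, w, e) \<in> edges c \<Longrightarrow> walk_weight \<phi> u w (k + e)"
  using walk_weight_trans[OF _ walk_weight.step[OF _ _ walk_weight.refl]] by fastforce

text \<open>Edge sets are skew-symmetric, so a walk can be mirrored edge by edge without changing
  its weight.\<close>

lemma walk_weight_opp: "walk_weight \<phi> u v k \<Longrightarrow> walk_weight \<phi> (opp v) (opp u) k"
proof (induction rule: walk_weight.induct)
  case (step c u v e w k)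
  then show ?case
    using walk_weight_snoc[OF step.IH step.hyps(1) edges_opp[OF step.hyps(2)]]
    by (simp add: add.commute)
qed (rule walk_weight.refl)

lemma walk_weight_potential: "walk_weight \<phi> u v k \<Longrightarrow> potential \<phi> p \<Longrightarrow> p v \<le> p u + k"
  by (induction rule: walk_weight.induct) (auto dest: potential_edge)

section \<open>Integer bounds on distances and on \<open>\<rho>\<close>\<close>

lemma constraint_graph_simps:
  "verts (constraint_graph \<phi>) = UNIV" "arcs (constraint_graph \<phi>) = (\<Union>c\<in>\<phi>. edges c)"
  "tail (constraint_graph \<phi>) a = fst a" "head (constraint_graph \<phi>) a = fst (snd a)"
  by (simp_all add: constraint_graph_def)

lemma wSP_le_walk_weight:
  assumes "walk_weight \<phi> u v k"
  shows "wSP \<phi> u v \<le> ereal (real_of_int k)"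
proof -
  interpret G: wf_digraph "constraint_graph \<phi>"
    by (rule wf_digraph_constraint_graph)
  have "\<exists>p. G.awalk u p v \<and> G.awalk_cost weight p = real_of_int k"
    using assms
  proof (induction rule: walk_weight.induct)
    case (refl u)
    show ?case
      by (rule exI[of _ "[]"]) (simp add: G.awalk_Nil_iff constraint_graph_simps)
  next
    case (step c u v e w k)
    then obtain p where "G.awalk v p w" "G.awalk_cost weight p = real_of_int k"
      by blast
    with step.hyps show ?case
      by (intro exI[of _ "(u, v, e) # p"])
         (auto simp: G.awalk_Cons_iff constraint_graph_simps weight_def[of "(u, v, e)"])
  qed
  then show ?thesis
    unfolding wSP_def by (metis G.min_cost_le_walk_cost)
qed

text \<open>The edge inequalities telescope along every walk, so the difference bounds the infimum
  from below. In particular no distance is minus infinity.\<close>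

lemma potential_le_wSP:
  assumes "potential \<phi> p"
  shows "ereal (real_of_int (p v - p u)) \<le> wSP \<phi> u v"
proof -
  interpret G: wf_digraph "constraint_graph \<phi>"
    by (rule wf_digraph_constraint_graph)
  have "real_of_int (p v - p u) \<le> G.awalk_cost weight es" if "G.awalk u es v" for es
    using that
  proof (induction es arbitrary: u)
    case Nil
    then show ?case by (simp add: G.awalk_Nil_iff)
  next
    case (Cons a es)
    obtain x y e where a: "a = (x, y, e)" by (cases a)
    with Cons.prems have "x = u" "G.awalk y es v" "(x, y, e) \<in> (\<Union>c\<in>\<phi>. edges c)"
      by (auto simp: G.awalk_Cons_iff constraint_graph_simps)
    moreover from this assms have "p y \<le> p u + e"
      by (auto dest: potential_edge)
    ultimately show ?case
      using Cons.IH[of y] a by (simp add: weight_def)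
  qed
  then show ?thesis
    by (auto simp: wSP_def G.\<mu>_def intro: INF_greatest)
qed

text \<open>Antisymmetry gives \<open>- 2 * p u \<le> wSP \<phi> u (opp u)\<close>; since
  \<open>- p u\<close> is an integer, the bound survives halving and rounding down.\<close>

lemma potential_le_\<rho>:
  assumes "potential \<phi> p"
  shows "ereal (real_of_int (- p u)) \<le> \<rho> \<phi> u"
proof -
  have "ereal (real_of_int (- 2 * p u)) \<le> wSP \<phi> u (opp u)"
    using potential_le_wSP[OF assms, of "opp u" u] potential_opp[OF assms, of u] by simp
  moreover have "- p u \<le> \<lfloor>r / 2\<rfloor>" if "real_of_int (- 2 * p u) \<le> r" for r
    using that by (simp add: le_floor_iff)
  ultimately show ?thesis
    by (cases "wSP \<phi> u (opp u)") (auto simp: \<rho>_def Let_def simp flip: of_int_minus)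
qed

text \<open>Passes from extended reals to integers: either no walk limits the literal
  \<open>opp u\<close>, or \<open>m\<close> is an integer ceiling for it that respects all walks
  from \<open>u\<close> to \<open>opp u\<close>.\<close>

lemma \<rho>_cases:
  assumes "potential \<phi> p"
  obtains (infinite) "\<rho> \<phi> u = \<infinity>" "\<And>k. \<not> walk_weight \<phi> u (opp u) k"
  | (finite) m where "\<rho> \<phi> u = ereal (real_of_int m)" "- p u \<le> m"
      "\<And>k. walk_weight \<phi> u (opp u) k \<Longrightarrow> 2 * m \<le> k"
proof (cases "wSP \<phi> u (opp u)")
  case (real r)
  then have \<rho>: "\<rho> \<phi> u = ereal (real_of_int \<lfloor>r / 2\<rfloor>)"
    by (simp add: \<rho>_def)
  have "2 * \<lfloor>r / 2\<rfloor> \<le> k" if "walk_weight \<phi> u (opp u) k" for k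
  proof -
    have "r \<le> k" using wSP_le_walk_weight[OF that] real by simp
    then show ?thesis by linarith
  qed
  moreover have "- p u \<le> \<lfloor>r / 2\<rfloor>"
    using potential_le_\<rho>[OF assms, of u] \<rho> by simp
  ultimately show thesis
    using \<rho> finite by blast
next
  case PInf
  have "\<not> walk_weight \<phi> u (opp u) k" for k
    using wSP_le_walk_weight[of \<phi> u "opp u" k] PInf by auto
  with PInf show thesis
    by (intro infinite) (auto simp: \<rho>_def)
next
  case MInf
  then show thesis
    using potential_le_wSP[OF assms, of "opp u" u] by simp
qed

section \<open>Solutions with a prescribed literal value\<close>

lemma int_set_has_least:
  fixes S :: "int set"
  assumes "S \<noteq> {}" and "\<And>x. x \<in> S \<Longrightarrow> b \<le> x"
  shows "\<exists>m\<in>S. \<forall>x\<in>S. m \<le> x"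
proof -
  obtain m where "m \<in> S" "\<And>x. x \<in> S \<Longrightarrow> nat (m - b) \<le> nat (x - b)"
    using assms(1) ex_has_least_nat[of "\<lambda>x. x \<in> S" _ "\<lambda>x. nat (x - b)"] by blast
  then show ?thesis
    using assms(2) by (metis diff_ge_0_iff_ge diff_right_mono nat_le_eq_zle add_le_cancel_right
        diff_conv_add_uminus)
qed

text \<open>The set \<open>A u\<close> stands for its infimum \<open>q u\<close>, which may be \<open>\<infinity>\<close>.\<close>

lemma median_potential:
  assumes s: "potential \<phi> s"
    and edge: "\<And>c u v e k. c \<in> \<phi> \<Longrightarrow> (u, v, e) \<in> edges c \<Longrightarrow> k \<in> A u \<Longrightarrow> k + e \<in> A v"
    and nonneg: "\<And>u k l. k \<in> A u \<Longrightarrow> l \<in> A (opp u) \<Longrightarrow> 0 \<le> k + l"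
    and bdd: "\<And>u. \<exists>b. \<forall>k\<in>A u. b \<le> k"
  obtains t where "potential \<phi> t" "\<And>u k. k \<in> A u \<Longrightarrow> t u \<le> k"
    "\<And>u. s u \<le> t u \<or> (\<exists>k\<in>A u. k \<le> t u)"
proof -
  have ex: "\<exists>m\<in>insert z (A u). \<forall>k\<in>insert z (A u). m \<le> k" for z u
  proof -
    obtain b where "\<forall>k\<in>A u. b \<le> k" using bdd by blast
    then show ?thesis
      by (intro int_set_has_least[of _ "min b z"]) auto
  qed
  \<comment> \<open>\<open>p u\<close> is the minimum of \<open>s u\<close> and \<open>q u\<close>,
    where \<open>q u\<close> is the infimum of \<open>A u\<close>.\<close>
  have "\<forall>u. \<exists>m. m \<in> insert (s u) (A u) \<and> (\<forall>k\<in>insert (s u) (A u). m \<le> k)"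
    using ex by blast
  then obtain p where p: "\<And>u. p u = s u \<or> p u \<in> A u"
      "\<And>u. p u \<le> s u" "\<And>u k. k \<in> A u \<Longrightarrow> p u \<le> k"
    by (metis insert_iff)
  \<comment> \<open>\<open>- n u\<close> is the maximum of \<open>p u\<close> and
    \<open>- q (opp u)\<close>. As \<open>nonneg\<close> gives \<open>- q (opp u) \<le> q u\<close>,
    this is the median.\<close>
  have "\<forall>u. \<exists>m. m \<in> insert (- p u) (A (opp u)) \<and> (\<forall>k\<in>insert (- p u) (A (opp u)). m \<le> k)"
    using ex by blast
  then obtain n where n: "\<And>u. n u = - p u \<or> n u \<in> A (opp u)"
      "\<And>u. n u \<le> - p u" "\<And>u k. k \<in> A (opp u) \<Longrightarrow> n u \<le> k"
    by (metis insert_iff)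
  \<comment> \<open>Passing to \<open>opp u\<close> swaps the order of the two cut-offs; with the
    lower bound below the upper one, both orders give the same value.\<close>
  have n_opp: "n (opp u) = - n u" for u
  proof -
    have s_opp: "s (opp u) = - s u" by (rule potential_opp[OF s])
    have n': "n (opp u) = - p (opp u) \<or> n (opp u) \<in> A u"
      "\<And>k. k \<in> A u \<Longrightarrow> n (opp u) \<le> k"
      using n(1)[of "opp u"] n(3)[of _ "opp u"] by auto
    have "0 \<le> n u + n (opp u)"
      using n(1)[of u] n' p(2)[of u] p(2)[of "opp u"] p(3)[of _ u] p(3)[of _ "opp u"]
        nonneg[of _ u] s_opp by fastforce
    moreover have "n u + n (opp u) \<le> 0"
      using p(1)[of u] p(1)[of "opp u"] n(2)[of u] n(2)[of "opp u"] n(3)[of _ u] n'(2) s_opp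
      by fastforce
    ultimately show ?thesis by simp
  qed
  have p_edge: "p v \<le> p u + e" if "c \<in> \<phi>" "(u, v, e) \<in> edges c" for c u v e
    using p(1)[of u] p(2)[of v] p(3)[OF edge[OF that]] potential_edge[OF s that] by fastforce
  \<comment> \<open>If \<open>n v\<close> comes from \<open>A (opp v)\<close>, the mirrored edge
    from \<open>opp v\<close> to \<open>opp u\<close> carries the bound over; otherwise
    \<open>p_edge\<close> applies.\<close>
  have n_edge: "n u \<le> n v + e" if c: "c \<in> \<phi>" "(u, v, e) \<in> edges c" for c u v e
    using n(1)[of v] n(2)[of u] n(3)[OF edge[OF c(1) edges_opp[OF c(2)]]] p_edge[OF c]
    by fastforce
  show thesis
  proof (rule that[of "\<lambda>u. - n u"])
    show "potential \<phi> (\<lambda>u. - n u)"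
      using n_edge by (fastforce simp: potential_def n_opp)
    show "- n u \<le> k" if "k \<in> A u" for u k
      using n(3)[of k "opp u"] that n_opp[of u] by simp
    show "s u \<le> - n u \<or> (\<exists>k\<in>A u. k \<le> - n u)" for u
      using p(1)[of u] n(2)[of u] by fastforce
  qed
qed

text \<open>The last conclusion limits the side effects of the raise: a literal can fall below its
  value in \<open>s\<close> only if a walk from \<open>a\<close> or \<open>opp a\<close> accounts
  for its new value.\<close>

lemma raise_potential:
  assumes s: "potential \<phi> s" and "s a \<le> m"
    and m: "\<And>k. walk_weight \<phi> (opp a) a k \<Longrightarrow> 2 * m \<le> k"
  obtains t where "potential \<phi> t" "t a = m"
    "\<And>b. s b \<le> t b \<or> (\<exists>k. walk_weight \<phi> a b k \<and> m + k \<le> t b) \<or>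
       (\<exists>k. walk_weight \<phi> (opp a) b k \<and> k - m \<le> t b)"
proof -
  \<comment> \<open>These are the upper bounds forced along walks by giving \<open>a\<close> the
    value \<open>m\<close> and \<open>opp a\<close> the value \<open>- m\<close>.\<close>
  define A where
    "A x = {m + k |k. walk_weight \<phi> a x k} \<union> {k - m |k. walk_weight \<phi> (opp a) x k}" for x
  have s_opp: "s (opp u) = - s u" for u by (rule potential_opp[OF s])
  have edge: "k + e \<in> A v" if "c \<in> \<phi>" "(u, v, e) \<in> edges c" "k \<in> A u" for c u v e k
  proof -
    have "\<exists>l. k + e = m + l \<and> walk_weight \<phi> a v l" if "k = m + j" "walk_weight \<phi> a u j" for j
      using walk_weight_snoc[OF that(2) \<open>c \<in> \<phi>\<close> \<open>(u, v, e) \<in> edges c\<close>] that(1)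
      by (intro exI[of _ "j + e"]) simp
    moreover have "\<exists>l. k + e = l - m \<and> walk_weight \<phi> (opp a) v l"
      if "k = j - m" "walk_weight \<phi> (opp a) u j" for j
      using walk_weight_snoc[OF that(2) \<open>c \<in> \<phi>\<close> \<open>(u, v, e) \<in> edges c\<close>] that(1)
      by (intro exI[of _ "j + e"]) simp
    ultimately show ?thesis
      using that(3) by (auto simp: A_def)
  qed
  \<comment> \<open>Mirroring the second walk joins the two at \<open>u\<close>. Mixed starting
    points give a closed walk, of nonnegative weight. Two walks from \<open>a\<close> give one from
    \<open>a\<close> to \<open>opp a\<close>, handled by \<open>s a \<le> m\<close>; two from
    \<open>opp a\<close> give one from \<open>opp a\<close> to \<open>a\<close>, handled by the
    assumption \<open>m\<close>.\<close>
  have nonneg: "0 \<le> x + y" if x: "x \<in> A u" and y: "y \<in> A (opp u)" for u x y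
  proof -
    have join: "walk_weight \<phi> b (opp b') (k + l)"
      if "walk_weight \<phi> b u k" "walk_weight \<phi> b' (opp u) l" for b b' k l
      using walk_weight_trans[OF that(1)] walk_weight_opp[OF that(2)] by simp
    have "0 \<le> 2 * m + k + l" if "walk_weight \<phi> a u k" "walk_weight \<phi> a (opp u) l" for k l
      using walk_weight_potential[OF join[OF that] s] s_opp[of a] \<open>s a \<le> m\<close> by simp
    moreover have "0 \<le> k + l"
      if "walk_weight \<phi> a u k" "walk_weight \<phi> (opp a) (opp u) l" for k l
      using walk_weight_potential[OF join[OF that] s] by simp
    moreover have "0 \<le> k + l"
      if "walk_weight \<phi> (opp a) u k" "walk_weight \<phi> a (opp u) l" for k l
      using walk_weight_potential[OF join[OF that] s] by simp
    moreover have "0 \<le> k + l - 2 * m"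
      if "walk_weight \<phi> (opp a) u k" "walk_weight \<phi> (opp a) (opp u) l" for k l
      using m[of "k + l"] join[OF that] by simp
    ultimately show ?thesis
      using x y unfolding A_def by fastforce
  qed
  have bdd: "\<exists>b. \<forall>k\<in>A u. b \<le> k" for u
  proof -
    have "min (m + s u - s a) (s u + s a - m) \<le> k" if "k \<in> A u" for k
      using that walk_weight_potential[OF _ s, of a u] walk_weight_potential[OF _ s, of "opp a" u]
        s_opp[of a] unfolding A_def by fastforce
    then show ?thesis by blast
  qed
  show thesis
  proof (rule median_potential[of \<phi> s A])
    fix t
    assume t: "potential \<phi> t" "\<And>u k. k \<in> A u \<Longrightarrow> t u \<le> k"
      "\<And>u. s u \<le> t u \<or> (\<exists>k\<in>A u. k \<le> t u)"
    show thesis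
    proof (rule that[OF t(1)])
      \<comment> \<open>The empty walks bound \<open>a\<close> by \<open>m\<close> and
        \<open>opp a\<close> by \<open>- m\<close>, which together fix the value of
        \<open>a\<close>.\<close>
      have "m \<in> A a" "- m \<in> A (opp a)"
        using walk_weight.refl[of \<phi>] by (force simp: A_def)+
      then show "t a = m"
        using t(2)[of m a] t(2)[of "- m" "opp a"] potential_opp[OF t(1), of a] by simp
      show "s b \<le> t b \<or> (\<exists>k. walk_weight \<phi> a b k \<and> m + k \<le> t b) \<or>
         (\<exists>k. walk_weight \<phi> (opp a) b k \<and> k - m \<le> t b)" for b
        using t(3)[of b] unfolding A_def by blast
    qed
  qed (fact s | fact bdd | erule (2) edge | erule (1) nonneg)+
qed

text \<open>The core of completeness, with failure of the distance alternative expressed by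
  \<open>uv\<close> in terms of walks.\<close>

lemma ex_potential_exceeding:
  assumes s: "potential \<phi> s"
    and uv: "\<And>k. walk_weight \<phi> u v k \<Longrightarrow> e < k"
    and \<rho>: "\<not> \<rho> \<phi> u + \<rho> \<phi> (opp v) \<le> ereal (real_of_int e)"
  obtains t where "potential \<phi> t" "t u + e < t v"
proof -
  obtain n where n: "- s u \<le> n" "\<And>k. walk_weight \<phi> u (opp u) k \<Longrightarrow> 2 * n \<le> k"
    and n_\<rho>: "\<And>m. \<rho> \<phi> (opp v) = ereal (real_of_int m) \<Longrightarrow> e < n + m"
  proof (cases rule: \<rho>_cases[OF s, of u, case_names infinite finite])
    case infinite
    \<comment> \<open>\<open>m0\<close> is the value of \<open>\<rho> \<phi> (opp v)\<close> if that
      is finite, and arbitrary otherwise. With \<open>opp u\<close> unlimited, \<open>n\<close> can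
      be chosen large enough to compensate for \<open>m0\<close>.\<close>
    obtain m0 where "\<And>m. \<rho> \<phi> (opp v) = ereal (real_of_int m) \<Longrightarrow> m = m0"
      by (metis ereal.inject of_int_eq_iff)
    with infinite show thesis
      by (intro that[of "max (- s u) (e - m0 + 1)"]) fastforce+
  next
    case (finite n)
    with \<rho> show thesis
      by (intro that[of n]) auto
  qed
  obtain p where p: "potential \<phi> p" "p (opp u) = n"
    using raise_potential[OF s, of "opp u" n] n potential_opp[OF s, of u] by (metis opp_opp)
  \<comment> \<open>The ceiling \<open>\<rho> \<phi> (opp v)\<close> depends only on the graph, so
    it lies above the value of \<open>v\<close> in the new potential \<open>p\<close> as
    well.\<close>
  obtain m where m: "p v \<le> m" "\<And>k. walk_weight \<phi> (opp v) v k \<Longrightarrow> 2 * m \<le> k" "e < n + m"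
  proof (cases rule: \<rho>_cases[OF p(1), of "opp v", case_names infinite finite])
    case infinite
    then show thesis
      by (intro that[of "max (p v) (e - n + 1)"]) auto
  next
    case (finite m)
    with n_\<rho> potential_opp[OF p(1), of v] show thesis
      by (intro that[of m]) auto
  qed
  obtain t where t: "potential \<phi> t" "t v = m"
    and t_u: "p (opp u) \<le> t (opp u) \<or> (\<exists>k. walk_weight \<phi> v (opp u) k \<and> m + k \<le> t (opp u)) \<or>
       (\<exists>k. walk_weight \<phi> (opp v) (opp u) k \<and> k - m \<le> t (opp u))"
    using raise_potential[OF p(1) m(1,2)] by metis
  \<comment> \<open>The second raise must not undo the first. A drop of \<open>opp u\<close> forced
    by a walk from \<open>v\<close> is excluded because \<open>p v \<le> m\<close>; one forced by a
    walk from \<open>opp v\<close> mirrors to a walk from \<open>u\<close> to \<open>v\<close>,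
    whose weight exceeds \<open>e\<close>.\<close>
  from t_u have "e < m + t (opp u)"
  proof (elim disjE exE conjE)
    fix k assume "walk_weight \<phi> v (opp u) k" "m + k \<le> t (opp u)"
    then show ?thesis
      using walk_weight_potential[OF _ p(1), of v "opp u" k] m p(2) by linarith
  next
    fix k assume "walk_weight \<phi> (opp v) (opp u) k" "k - m \<le> t (opp u)"
    then show ?thesis
      using uv[of k] walk_weight_opp[of \<phi> "opp v" "opp u" k] by simp
  qed (use m p in linarith)
  with t show thesis
    using that potential_opp[OF t(1), of u] by simp
qed

section \<open>Entailment and the edge criterion\<close>

theorem theorem4:
  fixes \<phi> :: "'x utvpi set" and c :: "'x utvpi"
  assumes "satisfiable \<phi>"
  shows "\<phi> \<Turnstile> c \<longleftrightarrow>
    (\<forall>(u, v, e) \<in> edges c.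
       wSP \<phi> u v \<le> ereal (real_of_int e) \<or> \<rho> \<phi> u + \<rho> \<phi> (opp v) \<le> ereal (real_of_int e))"
    (is "_ \<longleftrightarrow> (\<forall>(u, v, e) \<in> edges c. ?short u v e)")
proof
  obtain s where s: "potential \<phi> (literal s)"
    using assms by (auto simp: satisfiable_def potential_literal_iff)
  assume entails: "\<phi> \<Turnstile> c"
  have "?short u v e" if c: "(u, v, e) \<in> edges c" for u v e
  proof (rule ccontr)
    assume "\<not> ?short u v e"
    then have "\<not> wSP \<phi> u v \<le> ereal (real_of_int e)"
      and \<rho>: "\<not> \<rho> \<phi> u + \<rho> \<phi> (opp v) \<le> ereal (real_of_int e)" by auto
    then have "e < k" if "walk_weight \<phi> u v k" for k
      using wSP_le_walk_weight[OF that]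
      by (meson ereal_less_eq(3) not_le of_int_le_iff order_trans)
    then obtain t where t: "potential \<phi> t" "t u + e < t v"
      using ex_potential_exceeding[OF s _ \<rho>] by metis
    then have "satisfies (\<lambda>x. t (Pos x)) c"
      using entails literal_potential[OF t(1)] potential_literal_iff[of \<phi> "\<lambda>x. t (Pos x)"]
      by (simp add: entails_def)
    then show False
      using c t literal_potential[OF t(1)] by (fastforce simp: satisfies_iff_edges)
  qed
  then show "\<forall>(u, v, e) \<in> edges c. ?short u v e" by blast
next
  assume short: "\<forall>(u, v, e) \<in> edges c. ?short u v e"
  show "\<phi> \<Turnstile> c"
    unfolding entails_def satisfies_iff_edges
  proof (intro allI impI, safe)
    fix s u v e
    assume "solution s \<phi>" and c: "(u, v, e) \<in> edges c"
    then have p: "potential \<phi> (literal s)"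
      by (simp add: potential_literal_iff)
    from short c have "?short u v e" by blast
    then show "literal s v \<le> literal s u + e"
    proof
      assume "wSP \<phi> u v \<le> ereal (real_of_int e)"
      with potential_le_wSP[OF p, of v u]
      have "ereal (real_of_int (literal s v - literal s u)) \<le> ereal (real_of_int e)"
        by (rule order_trans)
      then show ?thesis by simp
    next
      assume "\<rho> \<phi> u + \<rho> \<phi> (opp v) \<le> ereal (real_of_int e)"
      \<comment> \<open>The two summands are the lower bounds \<open>- literal s u\<close> and
        \<open>literal s v\<close>, so their sum is exactly the difference to be bounded.\<close>
      with add_mono[OF potential_le_\<rho>[OF p, of u] potential_le_\<rho>[OF p, of "opp v"]]
      have "ereal (real_of_int (- literal s u)) + ereal (real_of_int (- literal s (opp v)))
          \<le> ereal (real_of_int e)"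
        by (rule order_trans)
      then show ?thesis by (simp add: literal_opp)
    qed
  qed
qed

end
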